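(* Let $\mathbf{k}=(k_1,k_2)$ and $\mathbf{n}=(n_1,n_2)$ with $k_i<n_i\le m$ for $i\in\{1,2\}$. Then the weight distribution (the numbers $A_i(\mathcal{C})$ of codewords of rank weight $i$, $i=0,\dots,n_1+n_2$) of an $(\mathbf{n},\mathbf{k})$-MRD code $\mathcal{C}\subseteq\mathbb{F}_{q^m}^{n_1+n_2}$ depends only on $\mathbf{n},\mathbf{k},q$ and $m$.
   Context: An $[n,k]_{q^m/q}$ code is a $k$-dim $\mathbb{F}_{q^m}$-subspace of $\mathbb{F}_{q^m}^n$ with rank weight $w(v)=\dim_{\mathbb{F}_q}\langle v_1,\dots,v_n\rangle_{\mathbb{F}_q}$. For $n_i\le m$, an $[n_i,k_i]_{q^m/q}$ code is MRD if its minimum distance is $n_i-k_i+1$. With $N=n_1+n_2$, $K=k_1+k_2$, an $[N,K]_{q^m/q}$ code $\mathcal{C}$ is an $(\mathbf{n},\mathbf{k})$-MRD code if $\mathcal{C}=\mathcal{C}_1\oplus\mathcal{C}_2=\{(c_1,c_2):c_i\in\mathcal{C}_i\}$ for MRD codes $\mathcal{C}_i\subseteq\mathbb{F}_{q^m}^{n_i}$ of parameters $[n_i,k_i]_{q^m/q}$, and every codeword $(c_1,c_2)$ with $c_1\neq0$, $c_2\ne0$ has rank weight at least $N-K+1$. *)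

theory Defs
  imports "HOL-Analysis.Cartesian_Space"
begin

text \<open>
  The extension of finite fields from order \<open>q\<close> to order \<open>q ^ m\<close> is given by a field
  homomorphism \<open>\<iota>\<close> (automatically injective) between two finite fields of these orders.
\<close>

definition finite_field_extension ::
    "('q::{field,finite} \<Rightarrow> 'a::{field,finite}) \<Rightarrow> nat \<Rightarrow> nat \<Rightarrow> bool" where
  "finite_field_extension \<iota> q m \<longleftrightarrow>
     CARD('q) = q \<and> CARD('a) = q ^ m \<and> \<iota> 1 = 1 \<and>
     (\<forall>x y. \<iota> (x + y) = \<iota> x + \<iota> y) \<and> (\<forall>x y. \<iota> (x * y) = \<iota> x * \<iota> y)"

definition ext_scale :: "('q::field \<Rightarrow> 'a::field) \<Rightarrow> 'q \<Rightarrow> 'a \<Rightarrow> 'a" where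
  "ext_scale \<iota> a x = \<iota> a * x"

lemma vector_space_ext_scale:
  assumes "finite_field_extension \<iota> q m"
  shows "vector_space (ext_scale \<iota>)"
  using assms by unfold_locales
    (auto simp: finite_field_extension_def ext_scale_def algebra_simps)

definition rank_weight :: "('q::field \<Rightarrow> 'a::field) \<Rightarrow> 'a ^ 'n \<Rightarrow> nat" where
  "rank_weight \<iota> v =
     vector_space.dim (ext_scale \<iota>) (module.span (ext_scale \<iota>) (range (\<lambda>i. v $ i)))"

definition linear_code :: "nat \<Rightarrow> nat \<Rightarrow> ('a::field ^ 'n) set \<Rightarrow> bool" where
  "linear_code n k C \<longleftrightarrow> CARD('n) = n \<and> vec.subspace C \<and> vec.dim C = k"

text \<open>The zero code of length \<open>n\<close> has minimum distance \<open>n + 1\<close> by convention.\<close>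

definition min_distance :: "('q::field \<Rightarrow> 'a::field) \<Rightarrow> ('a ^ 'n) set \<Rightarrow> nat" where
  "min_distance \<iota> C =
     (if C = {0} then CARD('n) + 1
      else Inf {rank_weight \<iota> (u - v) | u v. u \<in> C \<and> v \<in> C \<and> u \<noteq> v})"

definition MRD_code :: "('q::field \<Rightarrow> 'a::field) \<Rightarrow> nat \<Rightarrow> nat \<Rightarrow> ('a ^ 'n) set \<Rightarrow> bool" where
  "MRD_code \<iota> n k C \<longleftrightarrow> linear_code n k C \<and> min_distance \<iota> C = n - k + 1"

definition vec_join :: "'a ^ 'n1 \<Rightarrow> 'a ^ 'n2 \<Rightarrow> 'a ^ ('n1 + 'n2)" where
  "vec_join u v = (\<chi> i. case i of Inl a \<Rightarrow> u $ a | Inr b \<Rightarrow> v $ b)"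

definition code_sum :: "('a ^ 'n1) set \<Rightarrow> ('a ^ 'n2) set \<Rightarrow> ('a ^ ('n1 + 'n2)) set" where
  "code_sum C1 C2 = {vec_join c1 c2 | c1 c2. c1 \<in> C1 \<and> c2 \<in> C2}"

definition nk_MRD_code :: "('q::field \<Rightarrow> 'a::field) \<Rightarrow> nat \<times> nat \<Rightarrow> nat \<times> nat \<Rightarrow>
    ('a ^ ('n1::finite + 'n2::finite)) set \<Rightarrow> bool" where
  "nk_MRD_code \<iota> = (\<lambda>(n1, n2) (k1, k2) C.
     linear_code (n1 + n2) (k1 + k2) C \<and>
     (\<exists>(C1 :: ('a ^ 'n1) set) (C2 :: ('a ^ 'n2) set).
        MRD_code \<iota> n1 k1 C1 \<and> MRD_code \<iota> n2 k2 C2 \<and> C = code_sum C1 C2 \<and>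
        (\<forall>c1\<in>C1. \<forall>c2\<in>C2. c1 \<noteq> 0 \<longrightarrow> c2 \<noteq> 0 \<longrightarrow>
           rank_weight \<iota> (vec_join c1 c2) \<ge> (n1 + n2) - (k1 + k2) + 1)))"

definition weight_distribution ::
    "('q::field \<Rightarrow> 'a::field) \<Rightarrow> ('a ^ 'n) set \<Rightarrow> nat \<Rightarrow> nat" where
  "weight_distribution \<iota> C i = card {c \<in> C. rank_weight \<iota> c = i}"

end

theory Submission imports Defs begin

text \<open>
  Put \<open>N = n1 + n2\<close>. A word \<open>c\<close> of rank weight \<open>w\<close> is orthogonal to exactly
  \<open>q ^ (N - w)\<close> vectors over the small field, so the sum of \<open>(q ^ (N - w)) ^ t\<close> over the code
  counts pairs of a codeword and \<open>t\<close> vectors orthogonal to it. The number of codewords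
  orthogonal to a set \<open>V\<close> of vectors turns out to depend only on the type of \<open>V\<close>, that is on
  the dimension of \<open>V\<close> and of its projections to the two blocks; and the number of vectors
  \<open>x\<close> which change the type of \<open>V\<close> in a given way when adjoined to it depends only on the type
  as well. Hence all these power sums are determined by the parameters, and since the numbers
  \<open>q ^ (N - w)\<close> are distinct, a Vandermonde argument recovers the weight distribution.
\<close>

section \<open>Counting in finite groups and vector spaces\<close>

text \<open>Every nonempty fibre in \<open>S\<close> is a translate of the kernel. Only additivity
  is asked of \<open>f\<close>, so this serves maps over either field.\<close>

lemma card_additive_image_kernel:
  fixes f :: "'x::ab_group_add \<Rightarrow> 'y::ab_group_add"
  assumes fin: "finite S" and diff: "\<And>x y. x \<in> S \<Longrightarrow> y \<in> S \<Longrightarrow> x - y \<in> S"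
    and add: "\<And>x y. x \<in> S \<Longrightarrow> y \<in> S \<Longrightarrow> x + y \<in> S"
    and f: "\<And>x y. f (x + y) = f x + f y"
  shows "card S = card (f ` S) * card {x \<in> S. f x = 0}"
proof -
  have fd: "f (x - y) = f x - f y" for x y
    using f[of "x - y" y] by (simp add: algebra_simps)
  have fib: "card {x \<in> S. f x = y} = card {x \<in> S. f x = 0}" if "y \<in> f ` S" for y
  proof -
    from that obtain a where a: "a \<in> S" "y = f a" by auto
    have "bij_betw (\<lambda>x. x + a) {x \<in> S. f x = 0} {x \<in> S. f x = y}"
      by (rule bij_betwI[where g = "\<lambda>x. x - a"]) (use a diff add f fd in auto)
    then show ?thesis by (simp add: bij_betw_same_card)
  qed
  have "card S = (\<Sum>y\<in>f ` S. card {x \<in> S. f x = y})"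
    using sum.image_gen[OF fin, of "\<lambda>_. 1::nat" f] by simp
  also have "\<dots> = card (f ` S) * card {x \<in> S. f x = 0}"
    using fib by simp
  finally show ?thesis .
qed

text \<open>Each element of the enlarged span is uniquely \<open>scale c b + v\<close>, which gives
  one factor \<open>CARD('a)\<close> per basis vector. The general locale covers coordinate spaces
  and the large field over the small one alike.\<close>

lemma (in vector_space) card_span_independent:
  assumes "finite (UNIV :: 'a set)" "finite B" "independent B"
  shows "finite (span B) \<and> card (span B) = CARD('a) ^ card B"
  using assms(2,3)
proof (induction B rule: finite_induct)
  case empty
  then show ?case by simp
next
  case (insert b B)
  have ind: "independent B" and b: "b \<notin> span B"
    using insert.prems insert.hyps by (auto simp: independent_insert)
  note IH = insert.IH[OF ind]
  have bij: "bij_betw (\<lambda>(c, v). scale c b + v) (UNIV \<times> span B) (span (insert b B))"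
    unfolding bij_betw_def
  proof
    show "inj_on (\<lambda>(c, v). scale c b + v) (UNIV \<times> span B)"
    proof (rule inj_onI, clarify)
      fix c v c' v'
      assume v: "v \<in> span B" "v' \<in> span B" and eq: "scale c b + v = scale c' b + v'"
      have "scale (c - c') b = v' - v"
        using eq by (simp add: scale_left_diff_distrib algebra_simps)
      then have m: "scale (c - c') b \<in> span B" using v by (simp add: span_diff)
      have "c = c'"
      proof (rule ccontr)
        assume "c \<noteq> c'"
        then have "scale (inverse (c - c')) (scale (c - c') b) = b" by simp
        with m b show False by (metis span_scale)
      qed
      with eq show "c = c' \<and> v = v'" by simp
    qed
    show "(\<lambda>(c, v). scale c b + v) ` (UNIV \<times> span B) = span (insert b B)"
    proof (intro equalityI subsetI)
      fix x assume "x \<in> (\<lambda>(c, v). scale c b + v) ` (UNIV \<times> span B)"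
      then obtain c v where "x = scale c b + v" "v \<in> span B" by auto
      then show "x \<in> span (insert b B)" by (auto simp: span_breakdown_eq intro!: exI[of _ c])
    next
      fix x assume "x \<in> span (insert b B)"
      then obtain c where "x - scale c b \<in> span B" by (auto simp: span_breakdown_eq)
      then show "x \<in> (\<lambda>(c, v). scale c b + v) ` (UNIV \<times> span B)"
        by (intro image_eqI[of _ _ "(c, x - scale c b)"]) auto
    qed
  qed
  have "finite ((UNIV :: 'a set) \<times> span B)" using IH assms(1) by simp
  then have fin: "finite (span (insert b B))" using bij bij_betw_finite by blast
  have "card (span (insert b B)) = card ((UNIV :: 'a set) \<times> span B)"
    using bij_betw_same_card[OF bij] by simp
  also have "\<dots> = CARD('a) ^ card (insert b B)"
    using IH insert.hyps by (simp add: card_cartesian_product)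
  finally show ?case using fin by simp
qed

lemma card_span_vec:
  fixes V :: "('a::{field,finite} ^ 'n) set"
  shows "card (vec.span V) = CARD('a) ^ vec.dim V"
proof -
  obtain B where B: "B \<subseteq> V" "vec.independent B" "V \<subseteq> vec.span B" "card B = vec.dim V"
    using vec.basis_exists by blast
  have "vec.span V = vec.span B"
    using B by (metis vec.span_mono vec.span_span subset_antisym)
  then show ?thesis using vec.card_span_independent[of B] B vec.finiteI_independent by auto
qed

lemma card_subspace_vec:
  fixes V :: "('a::{field,finite} ^ 'n) set"
  assumes "vec.subspace V"
  shows "card V = CARD('a) ^ vec.dim V"
  using card_span_vec[of V] assms by (simp add: vec.span_eq_iff[THEN iffD2])

lemma card_field_ge_2: "2 \<le> CARD('a::{field,finite})"
proof -
  have "card {0, 1::'a} \<le> CARD('a)" by (rule card_mono) auto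
  then show ?thesis by simp
qed

section \<open>Recovering multiplicities from power sums\<close>

text \<open>Vandermonde by elimination: the sum at \<open>Suc t\<close> minus \<open>z k\<close>
  times the sum at \<open>t\<close> loses the node \<open>k\<close> and multiplies the other
  coefficients by the nonzero \<open>z i - z k\<close>.\<close>

lemma power_sums_zero_imp_zero:
  fixes a z :: "'i \<Rightarrow> 'f::field"
  assumes "finite I" "inj_on z I" "\<And>t. (\<Sum>i\<in>I. a i * z i ^ t) = 0" "i \<in> I"
  shows "a i = 0"
  using assms
proof (induction I arbitrary: a i rule: finite_induct)
  case empty
  then show ?case by simp
next
  case (insert k I)
  have split: "a k * z k ^ t + (\<Sum>i\<in>I. a i * z i ^ t) = 0" for t
    using insert.prems(2)[of t] insert.hyps by simp
  have "(\<Sum>i\<in>I. (a i * (z i - z k)) * z i ^ t) = 0" for t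
  proof -
    have "(\<Sum>i\<in>I. (a i * (z i - z k)) * z i ^ t)
        = (\<Sum>i\<in>I. a i * z i ^ Suc t) - z k * (\<Sum>i\<in>I. a i * z i ^ t)"
      by (simp add: sum_distrib_left sum_subtractf algebra_simps)
    also have "\<dots> = 0"
    proof -
      have "(\<Sum>i\<in>I. a i * z i ^ Suc t) = - (a k * z k ^ Suc t)"
           "(\<Sum>i\<in>I. a i * z i ^ t) = - (a k * z k ^ t)"
        using split[of "Suc t"] split[of t] by (simp_all only: eq_neg_iff_add_eq_0 add.commute)
      then show ?thesis by simp
    qed
    finally show ?thesis .
  qed
  then have "a j * (z j - z k) = 0" if "j \<in> I" for j
    using insert.IH[of "\<lambda>i. a i * (z i - z k)" j] insert.prems(1) that by simp
  moreover have "z j \<noteq> z k" if "j \<in> I" for j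
    using insert.prems(1) insert.hyps(2) that by (auto simp: inj_on_def)
  ultimately have I0: "a j = 0" if "j \<in> I" for j using that by force
  then have "a k = 0" using split[of 0] by simp
  then show ?case using I0 insert.prems(3) by auto
qed

lemma moments_determine:
  fixes A B :: "nat \<Rightarrow> nat" and q N :: nat
  assumes q: "2 \<le> q"
    and eq: "\<And>t. (\<Sum>w\<le>N. A w * (q ^ (N - w)) ^ t) = (\<Sum>w\<le>N. B w * (q ^ (N - w)) ^ t)"
    and w: "w \<le> N"
  shows "A w = B w"
proof -
  have "real (A w) - real (B w) = 0"
  proof (rule power_sums_zero_imp_zero[where I = "{..N}" and z = "\<lambda>w. real (q ^ (N - w))"
        and a = "\<lambda>w. real (A w) - real (B w)"])
    show "inj_on (\<lambda>w. real (q ^ (N - w))) {..N}"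
      using q by (auto simp: inj_on_def)
    show "(\<Sum>w\<le>N. (real (A w) - real (B w)) * real (q ^ (N - w)) ^ t) = 0" for t
    proof -
      have "(\<Sum>w\<le>N. (real (A w) - real (B w)) * real (q ^ (N - w)) ^ t)
          = real (\<Sum>w\<le>N. A w * (q ^ (N - w)) ^ t) - real (\<Sum>w\<le>N. B w * (q ^ (N - w)) ^ t)"
        by (simp add: left_diff_distrib sum_subtractf)
      then show ?thesis by (simp only: eq diff_self)
    qed
  qed (use w in auto)
  then show ?thesis by simp
qed

section \<open>Orthogonality and the two blocks of coordinates\<close>

definition pairing :: "('q::field \<Rightarrow> 'a::field) \<Rightarrow> 'a ^ 'n \<Rightarrow> 'q ^ 'n \<Rightarrow> 'a" where
  "pairing \<iota> c x = (\<Sum>i\<in>UNIV. \<iota> (x $ i) * c $ i)"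

definition annihilated :: "('q::field \<Rightarrow> 'a::field) \<Rightarrow> ('a ^ 'n) set \<Rightarrow> ('q ^ 'n) set \<Rightarrow> ('a ^ 'n) set" where
  "annihilated \<iota> C V = {c \<in> C. \<forall>x\<in>V. pairing \<iota> c x = 0}"

definition fst_part :: "'a ^ ('n1::finite + 'n2::finite) \<Rightarrow> 'a ^ 'n1" where
  "fst_part x = (\<chi> i. x $ Inl i)"

definition snd_part :: "'a ^ ('n1::finite + 'n2::finite) \<Rightarrow> 'a ^ 'n2" where
  "snd_part x = (\<chi> i. x $ Inr i)"

lemma parts_vec_join [simp]: "fst_part (vec_join u v) = u" "snd_part (vec_join u v) = v"
  by (simp_all add: fst_part_def snd_part_def vec_join_def vec_eq_iff)

lemma vec_join_parts [simp]: "vec_join (fst_part x) (snd_part x) = x"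
  by (auto simp: fst_part_def snd_part_def vec_join_def vec_eq_iff split: sum.split)

lemma vec_join_eq_iff [simp]: "vec_join u v = vec_join u' v' \<longleftrightarrow> u = u' \<and> v = v'"
  by (metis parts_vec_join)

lemma vec_join_0 [simp]: "vec_join 0 0 = 0"
  by (auto simp: vec_join_def vec_eq_iff split: sum.split)

lemma parts_add:
  "fst_part (x + y) = fst_part x + fst_part y" "snd_part (x + y) = snd_part x + snd_part y"
  by (simp_all add: fst_part_def snd_part_def vec_eq_iff)

lemma linear_fst_part: "Vector_Spaces.linear (*s) (*s) (fst_part :: 'a::field ^ ('n1::finite + 'n2::finite) \<Rightarrow> _)"
  by unfold_locales (auto simp: fst_part_def vec_eq_iff algebra_simps)

lemma linear_snd_part: "Vector_Spaces.linear (*s) (*s) (snd_part :: 'a::field ^ ('n1::finite + 'n2::finite) \<Rightarrow> _)"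
  by unfold_locales (auto simp: snd_part_def vec_eq_iff algebra_simps)

lemma span_fst_part:
  fixes V :: "('a::field ^ ('n1::finite + 'n2::finite)) set"
  shows "vec.span (fst_part ` V) = fst_part ` vec.span V"
  by (rule vec.linear_span_image[OF linear_fst_part])

lemma span_snd_part:
  fixes V :: "('a::field ^ ('n1::finite + 'n2::finite)) set"
  shows "vec.span (snd_part ` V) = snd_part ` vec.span V"
  by (rule vec.linear_span_image[OF linear_snd_part])

lemma vec_dim_insert:
  fixes V :: "('a::field ^ 'n) set"
  shows "vec.dim (insert x V) = (if x \<in> vec.span V then vec.dim V else Suc (vec.dim V))"
  using vec.dim_insert[of x V] by simp

lemma pairing_vec_join:
  "pairing \<iota> (vec_join u v) x = pairing \<iota> u (fst_part x) + pairing \<iota> v (snd_part x)"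
proof -
  have "pairing \<iota> (vec_join u v) x = (\<Sum>i\<in>UNIV <+> UNIV. \<iota> (x $ i) * vec_join u v $ i)"
    by (simp add: pairing_def)
  also have "\<dots> = pairing \<iota> u (fst_part x) + pairing \<iota> v (snd_part x)"
    by (subst sum.Plus) (simp_all add: pairing_def fst_part_def snd_part_def vec_join_def)
  finally show ?thesis .
qed

lemma pairing_add_left: "pairing \<iota> (c + d) x = pairing \<iota> c x + pairing \<iota> d x"
  by (simp add: pairing_def sum.distrib algebra_simps)

lemma pairing_diff_left: "pairing \<iota> (c - d) x = pairing \<iota> c x - pairing \<iota> d x"
  by (simp add: pairing_def sum_subtractf algebra_simps)

lemma pairing_zero_left [simp]: "pairing \<iota> 0 x = 0"
  by (simp add: pairing_def)

section \<open>Rank weight as the size of a kernel\<close>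

locale ffext =
  fixes \<iota> :: "'q::{field,finite} \<Rightarrow> 'a::{field,finite}" and q m :: nat
  assumes ext: "finite_field_extension \<iota> q m"
begin

lemma card_base: "CARD('q) = q" and card_ext: "CARD('a) = q ^ m"
  and iota_add: "\<iota> (x + y) = \<iota> x + \<iota> y" and iota_mult: "\<iota> (x * y) = \<iota> x * \<iota> y"
  and iota_one: "\<iota> 1 = 1"
  using ext by (auto simp: finite_field_extension_def)

lemma iota_zero: "\<iota> 0 = 0"
  using iota_add[of 0 0] by (metis add_cancel_left_left add.right_neutral)

lemma q_ge_2: "2 \<le> q"
  using card_field_ge_2[where 'a = 'q] card_base by simp

text \<open>\<open>E.dim\<close> measures the large field over the small one and hence rank weight,
  whereas \<open>vec.dim\<close> refers to coordinate spaces over either field.\<close>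

sublocale E: vector_space "ext_scale \<iota>"
  by (rule vector_space_ext_scale[OF ext])

lemma pairing_add_right: "pairing \<iota> c (x + y) = pairing \<iota> c x + pairing \<iota> c y"
  by (simp add: pairing_def sum.distrib iota_add algebra_simps)

lemma pairing_scale_right: "pairing \<iota> c (a *s x) = \<iota> a * pairing \<iota> c x"
  by (simp add: pairing_def iota_mult sum_distrib_left algebra_simps)

lemma pairing_zero_right [simp]: "pairing \<iota> c 0 = 0"
  by (simp add: pairing_def iota_zero)

lemma subspace_pairing_kernel: "vec.subspace {x. pairing \<iota> c x = 0}"
  by (rule vec.subspaceI) (auto simp: pairing_add_right pairing_scale_right)

text \<open>The entries of \<open>x\<close> are the coefficients of a small-field combination of the
  coordinates of \<open>c\<close>; unit vectors produce the single coordinates.\<close>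

lemma range_pairing: "range (pairing \<iota> c) = E.span (range (\<lambda>i. c $ i))"
proof (intro equalityI subsetI)
  fix y assume "y \<in> range (pairing \<iota> c)"
  then obtain x where "y = (\<Sum>i\<in>UNIV. ext_scale \<iota> (x $ i) (c $ i))"
    by (auto simp: pairing_def ext_scale_def)
  then show "y \<in> E.span (range (\<lambda>i. c $ i))"
    by (simp add: E.span_sum E.span_scale E.span_base)
next
  fix y assume "y \<in> E.span (range (\<lambda>i. c $ i))"
  then show "y \<in> range (pairing \<iota> c)"
  proof (induction rule: E.span_induct_alt)
    case base
    show ?case by (rule image_eqI[of _ _ 0]) auto
  next
    case (step a v y)
    then obtain i x where ix: "v = c $ i" "y = pairing \<iota> c x" by auto
    have "pairing \<iota> c (axis i 1) = (\<Sum>j\<in>UNIV. if j = i then c $ j else 0)"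
      unfolding pairing_def by (rule sum.cong) (auto simp: axis_def iota_one iota_zero)
    then have "pairing \<iota> c (axis i 1) = c $ i" by simp
    then show ?case
      using ix by (intro image_eqI[of _ _ "a *s axis i 1 + x"])
        (auto simp: pairing_add_right pairing_scale_right ext_scale_def)
  qed
qed

lemma card_range_pairing: "card (range (pairing \<iota> c)) = q ^ rank_weight \<iota> c"
proof -
  let ?S = "range (\<lambda>i. c $ i)"
  obtain B where B: "B \<subseteq> ?S" "E.independent B" "?S \<subseteq> E.span B" "card B = E.dim ?S"
    using E.basis_exists by blast
  have "E.span ?S = E.span B"
    using B by (metis E.span_mono E.span_span subset_antisym)
  moreover have "E.dim (E.span ?S) = E.dim ?S" by (rule E.dim_span)
  moreover have "card (E.span B) = q ^ card B"
    using E.card_span_independent[of B] B card_base by (auto intro: finite_subset)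
  ultimately show ?thesis
    using B by (simp add: range_pairing rank_weight_def)
qed

text \<open>Rank-nullity in counting form.\<close>

lemma card_pairing_kernel_mult:
  fixes c :: "'a ^ 'n"
  shows "q ^ rank_weight \<iota> c * card {x. pairing \<iota> c x = 0} = q ^ CARD('n)"
  using card_additive_image_kernel[of "UNIV :: ('q ^ 'n) set" "pairing \<iota> c"]
  by (simp add: pairing_add_right card_range_pairing card_base)

lemma rank_weight_le:
  fixes c :: "'a ^ 'n"
  shows "rank_weight \<iota> c \<le> CARD('n)"
proof -
  have "q ^ rank_weight \<iota> c dvd q ^ CARD('n)"
    using card_pairing_kernel_mult[of c] by (metis dvd_triv_left)
  then show ?thesis using q_ge_2 by (simp add: power_dvd_imp_le)
qed

lemma card_pairing_kernel:
  fixes c :: "'a ^ 'n"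
  shows "card {x. pairing \<iota> c x = 0} = q ^ (CARD('n) - rank_weight \<iota> c)"
proof -
  have "q ^ CARD('n) = q ^ rank_weight \<iota> c * q ^ (CARD('n) - rank_weight \<iota> c)"
    using rank_weight_le[of c] by (simp flip: power_add)
  with card_pairing_kernel_mult[of c] show ?thesis using q_ge_2 by simp
qed

lemma rank_weight_le_of_card:
  fixes c :: "'a ^ 'n"
  assumes "q ^ d \<le> card {x. pairing \<iota> c x = 0}"
  shows "d + rank_weight \<iota> c \<le> CARD('n)"
  using assms rank_weight_le[of c] q_ge_2 by (simp add: card_pairing_kernel)

lemma annihilated_span: "annihilated \<iota> C (vec.span V) = annihilated \<iota> C V"
proof -
  have "pairing \<iota> c x = 0" if "\<forall>x\<in>V. pairing \<iota> c x = 0" "x \<in> vec.span V" for c x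
    using vec.span_minimal[OF _ subspace_pairing_kernel, of V c] that by auto
  then show ?thesis by (auto simp: annihilated_def vec.span_base)
qed

text \<open>The span of \<open>V\<close> lies in the kernel of the pairing with \<open>c\<close>,
  whose size is fixed by the weight of \<open>c\<close>.\<close>

lemma annihilated_rank_weight:
  fixes c :: "'a ^ 'n"
  assumes "\<And>x. x \<in> V \<Longrightarrow> pairing \<iota> c x = 0"
  shows "vec.dim V + rank_weight \<iota> c \<le> CARD('n)"
proof (rule rank_weight_le_of_card)
  have "vec.span V \<subseteq> {x. pairing \<iota> c x = 0}"
    using assms by (intro vec.span_minimal subspace_pairing_kernel) auto
  then have "card (vec.span V) \<le> card {x. pairing \<iota> c x = 0}"
    by (intro card_mono) auto
  then show "q ^ vec.dim V \<le> card {x. pairing \<iota> c x = 0}"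
    by (simp add: card_span_vec card_base)
qed

text \<open>The new condition cuts out the kernel of an additive map into the large field.\<close>

lemma card_annihilated_insert:
  fixes C :: "('a ^ 'n) set"
  assumes "vec.subspace C"
  shows "card (annihilated \<iota> C V) \<le> CARD('a) * card (annihilated \<iota> C (insert v V))"
proof -
  let ?S = "annihilated \<iota> C V"
  have "card ?S = card ((\<lambda>c. pairing \<iota> c v) ` ?S) * card {c \<in> ?S. pairing \<iota> c v = 0}"
    using assms by (intro card_additive_image_kernel)
      (auto simp: annihilated_def pairing_add_left pairing_diff_left vec.subspace_add vec.subspace_diff)
  also have "{c \<in> ?S. pairing \<iota> c v = 0} = annihilated \<iota> C (insert v V)"
    by (auto simp: annihilated_def)
  also have "card ((\<lambda>c. pairing \<iota> c v) ` ?S) \<le> CARD('a)"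
    by (rule card_mono) auto
  finally show ?thesis by simp
qed

text \<open>A basis of \<open>V\<close> imposes the same conditions as \<open>V\<close>, and each of
  them divides the count by at most \<open>CARD('a)\<close>.\<close>

lemma card_annihilated_lower:
  fixes C :: "('a ^ 'n) set"
  assumes C: "vec.subspace C"
  shows "CARD('a) ^ (vec.dim C - vec.dim V) \<le> card (annihilated \<iota> C V)"
proof -
  obtain B where B: "B \<subseteq> V" "vec.independent B" "V \<subseteq> vec.span B" "card B = vec.dim V"
    using vec.basis_exists by blast
  have "finite B" using B vec.finiteI_independent by blast
  then have step: "card C \<le> CARD('a) ^ card B * card (annihilated \<iota> C B)"
  proof (induction B rule: finite_induct)
    case empty
    then show ?case by (simp add: annihilated_def)
  next
    case (insert b B)
    have "card C \<le> CARD('a) ^ card B * card (annihilated \<iota> C B)" by fact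
    also have "\<dots> \<le> CARD('a) ^ card B * (CARD('a) * card (annihilated \<iota> C (insert b B)))"
      by (intro mult_left_mono card_annihilated_insert C) auto
    finally show ?case using insert.hyps by (simp add: algebra_simps)
  qed
  have "vec.span V = vec.span B"
    using B by (metis vec.span_mono vec.span_span subset_antisym)
  then have "annihilated \<iota> C B = annihilated \<iota> C V" by (metis annihilated_span)
  with step B have le: "CARD('a) ^ vec.dim C \<le> CARD('a) ^ vec.dim V * card (annihilated \<iota> C V)"
    by (simp add: card_subspace_vec[OF C])
  show ?thesis
  proof (cases "vec.dim V \<le> vec.dim C")
    case True
    then have "CARD('a) ^ vec.dim C = CARD('a) ^ vec.dim V * CARD('a) ^ (vec.dim C - vec.dim V)"
      by (simp flip: power_add)
    with le show ?thesis by simp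
  next
    case False
    \<comment> \<open>The exponent truncates to 0 here, and the zero word alone reaches the bound
      1.\<close>
    have "0 \<in> annihilated \<iota> C V" using C by (simp add: annihilated_def vec.subspace_0)
    then have "0 < card (annihilated \<iota> C V)" by (auto simp: card_gt_0_iff)
    with False show ?thesis by simp
  qed
qed

section \<open>Words of an MRD code orthogonal to given vectors\<close>

lemma MRD_rank_weight:
  fixes C :: "('a ^ 'n) set"
  assumes "MRD_code \<iota> n k C" "c \<in> C" "c \<noteq> 0"
  shows "n - k + 1 \<le> rank_weight \<iota> c"
proof -
  have "0 \<in> C" using assms by (auto simp: MRD_code_def linear_code_def vec.subspace_0)
  then have "rank_weight \<iota> c \<in> {rank_weight \<iota> (u - v) | u v. u \<in> C \<and> v \<in> C \<and> u \<noteq> v}"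
    using assms(2,3) by (intro CollectI exI[of _ c] exI[of _ 0]) auto
  then have "Inf {rank_weight \<iota> (u - v) | u v. u \<in> C \<and> v \<in> C \<and> u \<noteq> v} \<le> rank_weight \<iota> c"
    by (intro cInf_lower) auto
  then show ?thesis
    using assms by (auto simp: MRD_code_def min_distance_def split: if_splits)
qed

lemma MRD_word_eq_0:
  fixes C :: "('a ^ 'n) set"
  assumes C: "MRD_code \<iota> n k C" and "k < n" and c: "c \<in> C" and "k + rank_weight \<iota> c \<le> n"
  shows "c = 0"
proof (rule ccontr)
  assume "c \<noteq> 0"
  with MRD_rank_weight[OF C c] assms show False by simp
qed

lemma exists_not_in_span:
  fixes V :: "('q ^ 'n) set"
  assumes "vec.dim V < CARD('n)"
  obtains v where "v \<notin> vec.span V"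
proof -
  have "vec.span V \<noteq> UNIV"
    using assms by (metis vec.dim_span vec_dim_card nless_le)
  then show ?thesis using that by auto
qed

lemma card_annihilated_le_insert:
  fixes C :: "('a ^ 'n) set"
  assumes "vec.subspace C" "card (annihilated \<iota> C (insert v V)) \<le> CARD('a) ^ j" "i = Suc j"
  shows "card (annihilated \<iota> C V) \<le> CARD('a) ^ i"
  using order_trans[OF card_annihilated_insert[OF assms(1)] mult_left_mono[OF assms(2)]] assms(3)
  by simp

text \<open>The lower bound is linear algebra. For the upper bound, independent vectors are adjoined
  until the dimension reaches \<open>k\<close>, each losing at most a factor
  \<open>CARD('a)\<close>; then an orthogonal word has weight at most \<open>n - k\<close> and
  vanishes.\<close>

lemma card_annihilated_MRD:
  fixes C :: "('a ^ 'n) set"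
  assumes C: "MRD_code \<iota> n k C" and kn: "k < n"
  shows "card (annihilated \<iota> C V) = CARD('a) ^ (k - vec.dim V)"
proof (rule antisym)
  have sub: "vec.subspace C" and dim: "vec.dim C = k" and n: "CARD('n) = n"
    using C by (auto simp: MRD_code_def linear_code_def)
  show "CARD('a) ^ (k - vec.dim V) \<le> card (annihilated \<iota> C V)"
    using card_annihilated_lower[OF sub] dim by simp
  show "card (annihilated \<iota> C V) \<le> CARD('a) ^ (k - vec.dim V)"
  proof (induction "k - vec.dim V" arbitrary: V)
    case 0
    have "annihilated \<iota> C V \<subseteq> {0}"
    proof
      fix c assume c: "c \<in> annihilated \<iota> C V"
      then have "vec.dim V + rank_weight \<iota> c \<le> n"
        using annihilated_rank_weight[of V c] n by (auto simp: annihilated_def)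
      with 0 c show "c \<in> {0}"
        using MRD_word_eq_0[OF C kn, of c] by (auto simp: annihilated_def)
    qed
    then have "card (annihilated \<iota> C V) \<le> 1"
      using card_mono[of "{0}" "annihilated \<iota> C V"] by simp
    with 0 show ?case by simp
  next
    case (Suc j)
    \<comment> \<open>The dimension is still below \<open>k\<close>, so \<open>k < n\<close> leaves
      room for a new vector.\<close>
    have "vec.dim V < CARD('n)" using Suc.hyps(2) kn n by simp
    then obtain v where v: "v \<notin> vec.span V" by (rule exists_not_in_span)
    have j: "j = k - vec.dim (insert v V)" using v Suc.hyps(2) by (simp add: vec_dim_insert)
    have "card (annihilated \<iota> C (insert v V)) \<le> CARD('a) ^ j"
      using Suc.hyps(1)[OF j] by (simp only: j[symmetric])
    then show ?case by (rule card_annihilated_le_insert[OF sub _ Suc.hyps(2)[symmetric]])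
  qed
qed

end

text \<open>If \<open>r1 + k2 \<le> r\<close> then \<open>V\<close> contains enough vectors supported on the second block to force
  the second component of an orthogonal codeword to vanish, which leaves an MRD code; symmetrically
  for \<open>r2 + k1 \<le> r\<close>. The truncated differences account for the case of no nonzero codeword.\<close>

definition type_weight :: "nat \<Rightarrow> nat \<Rightarrow> nat \<Rightarrow> nat \<Rightarrow> nat \<Rightarrow> nat \<Rightarrow> nat" where
  "type_weight Q k1 k2 r r1 r2 =
     (if r1 + k2 \<le> r then Q ^ (k1 - r1)
      else if r2 + k1 \<le> r then Q ^ (k2 - r2)
      else Q ^ (k1 + k2 - r))"

section \<open>Orthogonal words in a sum of two MRD codes, counted by type\<close>

locale nk_MRD = ffext \<iota> q m
  for \<iota> :: "'q::{field,finite} \<Rightarrow> 'a::{field,finite}" and q m :: nat +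
  fixes C1 :: "('a ^ 'n1) set" and C2 :: "('a ^ 'n2) set" and n1 n2 k1 k2 :: nat
  assumes k1: "k1 < n1" and k2: "k2 < n2"
    and C1: "MRD_code \<iota> n1 k1 C1" and C2: "MRD_code \<iota> n2 k2 C2"
    and code: "linear_code (n1 + n2) (k1 + k2) (code_sum C1 C2)"
    and weight: "\<And>c1 c2. c1 \<in> C1 \<Longrightarrow> c2 \<in> C2 \<Longrightarrow> c1 \<noteq> 0 \<Longrightarrow> c2 \<noteq> 0 \<Longrightarrow>
      n1 + n2 - (k1 + k2) + 1 \<le> rank_weight \<iota> (vec_join c1 c2)"
begin

abbreviation "C \<equiv> code_sum C1 C2"

lemma card_indices: "CARD('n1) = n1" "CARD('n2) = n2"
  using C1 C2 by (auto simp: MRD_code_def linear_code_def)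

lemma subspace_C: "vec.subspace C" and dim_C: "vec.dim C = k1 + k2"
  using code by (auto simp: linear_code_def)

lemma zero_in: "0 \<in> C1" "0 \<in> C2"
  using C1 C2 by (auto simp: MRD_code_def linear_code_def vec.subspace_0)

text \<open>The span of \<open>V\<close> embeds into the product of the spans of its projections;
  comparing sizes compares exponents.\<close>

lemma dim_le_parts:
  fixes V :: "('q ^ ('n1 + 'n2)) set"
  shows "vec.dim V \<le> vec.dim (fst_part ` V) + vec.dim (snd_part ` V)"
proof -
  let ?P = "vec.span (fst_part ` V) \<times> vec.span (snd_part ` V)"
  have "vec.span V \<subseteq> (\<lambda>(u, v). vec_join u v) ` ?P"
  proof
    fix x assume "x \<in> vec.span V"
    then show "x \<in> (\<lambda>(u, v). vec_join u v) ` ?P"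
      by (intro image_eqI[of _ _ "(fst_part x, snd_part x)"]) (auto simp: span_fst_part span_snd_part)
  qed
  then have "card (vec.span V) \<le> card ((\<lambda>(u, v). vec_join u v) ` ?P)" by (intro card_mono) auto
  also have "\<dots> \<le> card ?P" by (rule card_image_le) auto
  finally have "q ^ vec.dim V \<le> q ^ (vec.dim (fst_part ` V) + vec.dim (snd_part ` V))"
    by (simp add: card_cartesian_product card_span_vec card_base power_add)
  then show ?thesis using q_ge_2 by simp
qed

text \<open>The vectors in the span of \<open>V\<close> with zero first block form a space of
  dimension at least \<open>k2\<close>, and on them only \<open>c2\<close> contributes to the
  pairing. So \<open>c2\<close> has weight at most \<open>n2 - k2\<close>, too small for a nonzero
  word of \<open>C2\<close>.\<close>

lemma annihilated_snd_eq_0: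
  assumes V: "vec.dim (fst_part ` V) + k2 \<le> vec.dim V"
    and c2: "c2 \<in> C2" and ann: "\<And>x. x \<in> V \<Longrightarrow> pairing \<iota> (vec_join c1 c2) x = 0"
  shows "c2 = 0"
proof -
  let ?K = "{x \<in> vec.span V. fst_part x = 0}"
  have "card (vec.span V) = card (fst_part ` vec.span V) * card ?K"
    by (rule card_additive_image_kernel) (auto simp: parts_add vec.span_add vec.span_diff)
  then have "q ^ vec.dim V = q ^ vec.dim (fst_part ` V) * card ?K"
    by (simp add: card_span_vec card_base flip: span_fst_part)
  moreover have "q ^ (vec.dim (fst_part ` V) + k2) \<le> q ^ vec.dim V"
    using V q_ge_2 by (intro power_increasing) auto
  ultimately have "q ^ k2 \<le> card ?K" using q_ge_2 by (simp add: power_add)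
  also have "\<dots> = card (snd_part ` ?K)"
    by (rule card_image[symmetric]) (metis (mono_tags, lifting) inj_onI mem_Collect_eq vec_join_parts)
  also have "\<dots> \<le> card {y. pairing \<iota> c2 y = 0}"
  proof (rule card_mono)
    have "pairing \<iota> c2 (snd_part x) = 0" if "x \<in> ?K" for x
    proof -
      have "vec.span V \<subseteq> {x. pairing \<iota> (vec_join c1 c2) x = 0}"
        using ann by (intro vec.span_minimal subspace_pairing_kernel) auto
      then have "pairing \<iota> (vec_join c1 c2) x = 0" using that by auto
      then show ?thesis using that by (simp add: pairing_vec_join)
    qed
    then show "snd_part ` ?K \<subseteq> {y. pairing \<iota> c2 y = 0}" by auto
  qed auto
  finally have "k2 + rank_weight \<iota> c2 \<le> n2"
    using rank_weight_le_of_card card_indices by metis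
  then show ?thesis using MRD_word_eq_0[OF C2 k2 c2] by simp
qed

text \<open>Mirror image of \<open>annihilated_snd_eq_0\<close>.\<close>

lemma annihilated_fst_eq_0:
  assumes V: "vec.dim (snd_part ` V) + k1 \<le> vec.dim V"
    and c1: "c1 \<in> C1" and ann: "\<And>x. x \<in> V \<Longrightarrow> pairing \<iota> (vec_join c1 c2) x = 0"
  shows "c1 = 0"
proof -
  let ?K = "{x \<in> vec.span V. snd_part x = 0}"
  have "card (vec.span V) = card (snd_part ` vec.span V) * card ?K"
    by (rule card_additive_image_kernel) (auto simp: parts_add vec.span_add vec.span_diff)
  then have "q ^ vec.dim V = q ^ vec.dim (snd_part ` V) * card ?K"
    by (simp add: card_span_vec card_base flip: span_snd_part)
  moreover have "q ^ (vec.dim (snd_part ` V) + k1) \<le> q ^ vec.dim V"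
    using V q_ge_2 by (intro power_increasing) auto
  ultimately have "q ^ k1 \<le> card ?K" using q_ge_2 by (simp add: power_add)
  also have "\<dots> = card (fst_part ` ?K)"
    by (rule card_image[symmetric]) (metis (mono_tags, lifting) inj_onI mem_Collect_eq vec_join_parts)
  also have "\<dots> \<le> card {y. pairing \<iota> c1 y = 0}"
  proof (rule card_mono)
    have "pairing \<iota> c1 (fst_part x) = 0" if "x \<in> ?K" for x
    proof -
      have "vec.span V \<subseteq> {x. pairing \<iota> (vec_join c1 c2) x = 0}"
        using ann by (intro vec.span_minimal subspace_pairing_kernel) auto
      then have "pairing \<iota> (vec_join c1 c2) x = 0" using that by auto
      then show ?thesis using that by (simp add: pairing_vec_join)
    qed
    then show "fst_part ` ?K \<subseteq> {y. pairing \<iota> c1 y = 0}" by auto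
  qed auto
  finally have "k1 + rank_weight \<iota> c1 \<le> n1"
    using rank_weight_le_of_card card_indices by metis
  then show ?thesis using MRD_word_eq_0[OF C1 k1 c1] by simp
qed

text \<open>Once the second component is forced to vanish, only the first is tested, against the
  projection of \<open>V\<close>, and the count for \<open>C1\<close> applies.\<close>

lemma annihilated_fst_only:
  assumes "vec.dim (fst_part ` V) + k2 \<le> vec.dim V"
  shows "card (annihilated \<iota> C V) = CARD('a) ^ (k1 - vec.dim (fst_part ` V))"
proof -
  have "annihilated \<iota> C V = (\<lambda>c. vec_join c 0) ` annihilated \<iota> C1 (fst_part ` V)"
  proof (intro equalityI subsetI)
    fix c assume "c \<in> annihilated \<iota> C V"
    then obtain c1 c2 where c: "c = vec_join c1 c2" "c1 \<in> C1" "c2 \<in> C2"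
      and ann: "\<And>x. x \<in> V \<Longrightarrow> pairing \<iota> (vec_join c1 c2) x = 0"
      by (auto simp: annihilated_def code_sum_def)
    have "c2 = 0" using annihilated_snd_eq_0[OF assms c(3) ann] .
    with c ann show "c \<in> (\<lambda>c. vec_join c 0) ` annihilated \<iota> C1 (fst_part ` V)"
      by (auto simp: annihilated_def pairing_vec_join)
  qed (use zero_in in \<open>auto simp: annihilated_def code_sum_def pairing_vec_join\<close>)
  moreover have "inj_on (\<lambda>c. vec_join c (0 :: 'a ^ 'n2)) (annihilated \<iota> C1 (fst_part ` V))"
    by (simp add: inj_on_def)
  ultimately show ?thesis by (simp add: card_image card_annihilated_MRD[OF C1 k1])
qed

lemma annihilated_snd_only:
  assumes "vec.dim (snd_part ` V) + k1 \<le> vec.dim V"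
  shows "card (annihilated \<iota> C V) = CARD('a) ^ (k2 - vec.dim (snd_part ` V))"
proof -
  have "annihilated \<iota> C V = (\<lambda>c. vec_join 0 c) ` annihilated \<iota> C2 (snd_part ` V)"
  proof (intro equalityI subsetI)
    fix c assume "c \<in> annihilated \<iota> C V"
    then obtain c1 c2 where c: "c = vec_join c1 c2" "c1 \<in> C1" "c2 \<in> C2"
      and ann: "\<And>x. x \<in> V \<Longrightarrow> pairing \<iota> (vec_join c1 c2) x = 0"
      by (auto simp: annihilated_def code_sum_def)
    have "c1 = 0" using annihilated_fst_eq_0[OF assms c(2) ann] .
    with c ann show "c \<in> (\<lambda>c. vec_join 0 c) ` annihilated \<iota> C2 (snd_part ` V)"
      by (auto simp: annihilated_def pairing_vec_join)
  qed (use zero_in in \<open>auto simp: annihilated_def code_sum_def pairing_vec_join\<close>)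
  moreover have "inj_on (\<lambda>c. vec_join (0 :: 'a ^ 'n1) c) (annihilated \<iota> C2 (snd_part ` V))"
    by (simp add: inj_on_def)
  ultimately show ?thesis by (simp add: card_image card_annihilated_MRD[OF C2 k2])
qed

lemma annihilated_trivial:
  assumes "k1 + k2 \<le> vec.dim V" "k1 \<le> vec.dim (fst_part ` V)" "k2 \<le> vec.dim (snd_part ` V)"
  shows "annihilated \<iota> C V \<subseteq> {0}"
proof
  fix c assume "c \<in> annihilated \<iota> C V"
  then obtain c1 c2 where c: "c = vec_join c1 c2" "c1 \<in> C1" "c2 \<in> C2"
    and ann: "\<And>x. x \<in> V \<Longrightarrow> pairing \<iota> (vec_join c1 c2) x = 0"
    by (auto simp: annihilated_def code_sum_def)
  have "vec.dim V + rank_weight \<iota> (vec_join c1 c2) \<le> n1 + n2"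
    using annihilated_rank_weight[OF ann] card_indices by simp
  \<comment> \<open>The weight is at most \<open>n1 + n2 - (k1 + k2)\<close>, just below what
    \<open>weight\<close> demands when both components are nonzero.\<close>
  then have "c1 = 0 \<or> c2 = 0"
    using weight[OF c(2,3)] assms(1) k1 k2 by fastforce
  moreover have "c1 = 0" if "c2 = 0"
  proof -
    have "vec.dim (fst_part ` V) + rank_weight \<iota> c1 \<le> n1"
      using annihilated_rank_weight[of "fst_part ` V" c1] ann that card_indices
      by (auto simp: pairing_vec_join)
    then show ?thesis using MRD_word_eq_0[OF C1 k1 c(2)] assms(2) by simp
  qed
  moreover have "c2 = 0" if "c1 = 0"
  proof -
    have "vec.dim (snd_part ` V) + rank_weight \<iota> c2 \<le> n2"
      using annihilated_rank_weight[of "snd_part ` V" c2] ann that card_indices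
      by (auto simp: pairing_vec_join)
    then show ?thesis using MRD_word_eq_0[OF C2 k2 c(3)] assms(3) by simp
  qed
  ultimately have "c1 = 0 \<and> c2 = 0" by blast
  then show "c \<in> {0}" using c by simp
qed

text \<open>Adjoin vectors to \<open>V\<close> one at a time until its dimension is \<open>k1 + k2\<close>; at each step at most
  one of the two hypotheses is tight (since \<open>dim V \<le> dim V\<^sub>1 + dim V\<^sub>2\<close>), and a tight one
  is preserved by choosing the new vector in the corresponding block.\<close>

lemma card_annihilated_upper:
  assumes "vec.dim V \<le> vec.dim (fst_part ` V) + k2" "vec.dim V \<le> vec.dim (snd_part ` V) + k1"
  shows "card (annihilated \<iota> C V) \<le> CARD('a) ^ (k1 + k2 - vec.dim V)"
  using assms
proof (induction "k1 + k2 - vec.dim V" arbitrary: V)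
  case 0
  then have "annihilated \<iota> C V \<subseteq> {0}" by (intro annihilated_trivial) auto
  then have "card (annihilated \<iota> C V) \<le> 1"
    using card_mono[of "{0}" "annihilated \<iota> C V"] by simp
  with 0 show ?case by simp
next
  case (Suc j)
  let ?W = "\<lambda>v. insert v V"
  have lt: "vec.dim V < k1 + k2" using Suc.hyps(2) by simp
  have "\<exists>v. v \<notin> vec.span V \<and> vec.dim (?W v) \<le> vec.dim (fst_part ` ?W v) + k2
      \<and> vec.dim (?W v) \<le> vec.dim (snd_part ` ?W v) + k1"
  proof -
    consider "vec.dim V = vec.dim (fst_part ` V) + k2"
      | "vec.dim V = vec.dim (snd_part ` V) + k1"
      | "vec.dim V < vec.dim (fst_part ` V) + k2" "vec.dim V < vec.dim (snd_part ` V) + k1"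
      using Suc.prems by linarith
    then show ?thesis
    proof cases
      case 1
      \<comment> \<open>By \<open>lt\<close> the first projection has dimension below
        \<open>k1\<close>, so its block has room. A vector supported there raises this dimension
        along with that of \<open>V\<close> and keeps the tight hypothesis.\<close>
      then have "vec.dim (fst_part ` V) < CARD('n1)" using lt k1 card_indices by simp
      then obtain u where u: "u \<notin> vec.span (fst_part ` V)" by (rule exists_not_in_span)
      let ?v = "vec_join u 0 :: 'q ^ ('n1 + 'n2)"
      have "?v \<notin> vec.span V" using u by (metis imageI parts_vec_join(1) span_fst_part)
      \<comment> \<open>By \<open>dim_le_parts\<close> the second projection has dimension at least
        \<open>k2\<close> while the first has less than \<open>k1\<close>, so the other hypothesis
        has slack.\<close>
      moreover have "vec.dim V < vec.dim (snd_part ` V) + k1"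
        using 1 lt dim_le_parts[of V] by linarith
      ultimately show ?thesis using 1 u by (intro exI[of _ ?v]) (simp add: vec_dim_insert)
    next
      case 2
      then have "vec.dim (snd_part ` V) < CARD('n2)" using lt k2 card_indices by simp
      then obtain u where u: "u \<notin> vec.span (snd_part ` V)" by (rule exists_not_in_span)
      let ?v = "vec_join 0 u :: 'q ^ ('n1 + 'n2)"
      have "?v \<notin> vec.span V" using u by (metis imageI parts_vec_join(2) span_snd_part)
      moreover have "vec.dim V < vec.dim (fst_part ` V) + k2"
        using 2 lt dim_le_parts[of V] by linarith
      ultimately show ?thesis using 2 u by (intro exI[of _ ?v]) (simp add: vec_dim_insert)
    next
      case 3
      \<comment> \<open>With slack in both hypotheses any vector outside the span will do.\<close>
      have "vec.dim V < CARD('n1 + 'n2)" using lt k1 k2 card_indices by simp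
      then obtain v where "v \<notin> vec.span V" by (rule exists_not_in_span)
      with 3 show ?thesis by (intro exI[of _ v]) (simp add: vec_dim_insert)
    qed
  qed
  then obtain v where v: "v \<notin> vec.span V" "vec.dim (?W v) \<le> vec.dim (fst_part ` ?W v) + k2"
    "vec.dim (?W v) \<le> vec.dim (snd_part ` ?W v) + k1" by blast
  have j: "j = k1 + k2 - vec.dim (?W v)" using v(1) Suc.hyps(2) by (simp add: vec_dim_insert)
  have "card (annihilated \<iota> C (insert v V)) \<le> CARD('a) ^ j"
    using Suc.hyps(1)[OF j v(2,3)] by (simp only: j[symmetric])
  then show ?case by (rule card_annihilated_le_insert[OF subspace_C _ Suc.hyps(2)[symmetric]])
qed

text \<open>In the first two cases one component is forced to vanish; in the last the general lower
  bound meets \<open>card_annihilated_upper\<close>.\<close>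

lemma card_annihilated:
  "card (annihilated \<iota> C V) = type_weight (q ^ m) k1 k2 (vec.dim V) (vec.dim (fst_part ` V)) (vec.dim (snd_part ` V))"
proof -
  consider "vec.dim (fst_part ` V) + k2 \<le> vec.dim V"
    | "\<not> vec.dim (fst_part ` V) + k2 \<le> vec.dim V" "vec.dim (snd_part ` V) + k1 \<le> vec.dim V"
    | "\<not> vec.dim (fst_part ` V) + k2 \<le> vec.dim V" "\<not> vec.dim (snd_part ` V) + k1 \<le> vec.dim V"
    by blast
  then show ?thesis
  proof cases
    case 1
    then show ?thesis using annihilated_fst_only card_ext by (simp add: type_weight_def)
  next
    case 2
    then show ?thesis using annihilated_snd_only card_ext by (simp add: type_weight_def)
  next
    case 3
    then have "card (annihilated \<iota> C V) \<le> CARD('a) ^ (k1 + k2 - vec.dim V)"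
      by (intro card_annihilated_upper) auto
    moreover have "CARD('a) ^ (k1 + k2 - vec.dim V) \<le> card (annihilated \<iota> C V)"
      using card_annihilated_lower[OF subspace_C] dim_C by simp
    ultimately show ?thesis using 3 card_ext by (simp add: type_weight_def)
  qed
qed

section \<open>Transitions between types\<close>

text \<open>Membership of the two components in \<open>U1\<close> and \<open>U2\<close> splits the
  space into four boxes, and the span \<open>S\<close> divides \<open>box U1 U2\<close> further. On
  each of the five pieces the new type is constant.\<close>

lemma sum_insert_type:
  fixes V :: "('q ^ ('n1 + 'n2)) set" and h :: "nat \<Rightarrow> nat \<Rightarrow> nat \<Rightarrow> nat"
  defines "r \<equiv> vec.dim V" and "r1 \<equiv> vec.dim (fst_part ` V)" and "r2 \<equiv> vec.dim (snd_part ` V)"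
  shows "(\<Sum>x\<in>UNIV. h (vec.dim (insert x V)) (vec.dim (fst_part ` insert x V))
            (vec.dim (snd_part ` insert x V)))
    = q ^ r * h r r1 r2 + (q ^ (r1 + r2) - q ^ r) * h (Suc r) r1 r2
      + q ^ r1 * (q ^ n2 - q ^ r2) * h (Suc r) r1 (Suc r2)
      + (q ^ n1 - q ^ r1) * q ^ r2 * h (Suc r) (Suc r1) r2
      + (q ^ n1 - q ^ r1) * (q ^ n2 - q ^ r2) * h (Suc r) (Suc r1) (Suc r2)"
    (is "(\<Sum>x\<in>UNIV. ?h x) = ?rhs")
proof -
  define S where "S = vec.span V"
  define U1 where "U1 = vec.span (fst_part ` V)"
  define U2 where "U2 = vec.span (snd_part ` V)"
  define box :: "('q ^ 'n1) set \<Rightarrow> ('q ^ 'n2) set \<Rightarrow> ('q ^ ('n1 + 'n2)) set"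
    where "box = (\<lambda>A B. {x. fst_part x \<in> A \<and> snd_part x \<in> B})"
  have card_box: "card (box A B) = card A * card B" for A B
  proof -
    have "bij_betw (\<lambda>x. (fst_part x, snd_part x)) (box A B) (A \<times> B)"
      by (rule bij_betwI[where g = "\<lambda>(u, v). vec_join u v"]) (auto simp: box_def)
    then show ?thesis by (simp add: bij_betw_same_card card_cartesian_product)
  qed
  have S_sub: "S \<subseteq> box U1 U2"
    by (auto simp: S_def U1_def U2_def box_def span_fst_part span_snd_part)
  have card_S: "card S = q ^ r" and card_U1: "card U1 = q ^ r1" and card_U2: "card U2 = q ^ r2"
    by (simp_all add: S_def U1_def U2_def r_def r1_def r2_def card_span_vec card_base)
  have card_compl: "card (- U1) = q ^ n1 - q ^ r1" "card (- U2) = q ^ n2 - q ^ r2"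
    using card_U1 card_U2 card_indices card_base by (simp_all add: Compl_eq_Diff_UNIV card_Diff_subset)
  have card_diff: "card (box U1 U2 - S) = q ^ (r1 + r2) - q ^ r"
    using S_sub by (simp add: card_Diff_subset card_box card_S card_U1 card_U2 power_add)
  have ind: "(\<Sum>x\<in>UNIV. if x \<in> T then a else 0) = card T * a"
    for T :: "('q ^ ('n1 + 'n2)) set" and a :: nat
    by (simp add: sum.If_cases)
  have "?h x = (if x \<in> S then h r r1 r2 else 0)
      + (if x \<in> box U1 U2 - S then h (Suc r) r1 r2 else 0)
      + (if x \<in> box U1 (- U2) then h (Suc r) r1 (Suc r2) else 0)
      + (if x \<in> box (- U1) U2 then h (Suc r) (Suc r1) r2 else 0)
      + (if x \<in> box (- U1) (- U2) then h (Suc r) (Suc r1) (Suc r2) else 0)" for x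
  proof -
    have d: "vec.dim (insert x V) = (if x \<in> S then r else Suc r)"
      "vec.dim (fst_part ` insert x V) = (if fst_part x \<in> U1 then r1 else Suc r1)"
      "vec.dim (snd_part ` insert x V) = (if snd_part x \<in> U2 then r2 else Suc r2)"
      by (simp_all add: vec_dim_insert S_def U1_def U2_def r_def r1_def r2_def)
    have "fst_part x \<in> U1 \<and> snd_part x \<in> U2" if "x \<in> S"
      using that S_sub by (auto simp: box_def)
    then show ?thesis unfolding d by (auto simp: box_def)
  qed
  then have "(\<Sum>x\<in>UNIV. ?h x) = card S * h r r1 r2 + card (box U1 U2 - S) * h (Suc r) r1 r2
      + card (box U1 (- U2)) * h (Suc r) r1 (Suc r2)
      + card (box (- U1) U2) * h (Suc r) (Suc r1) r2
      + card (box (- U1) (- U2)) * h (Suc r) (Suc r1) (Suc r2)"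
    by (simp only: sum.distrib ind)
  also have "\<dots> = ?rhs"
    by (simp only: card_diff) (simp only: card_box card_S card_U1 card_U2 card_compl)
  finally show ?thesis .
qed

end

section \<open>Moments of the weight distribution\<close>

context ffext
begin

text \<open>Carrying \<open>V\<close> along makes a recursion on \<open>t\<close> possible: one
  factor of the summand is traded for a vector adjoined to \<open>V\<close>.\<close>

definition moment :: "('a ^ 'n) set \<Rightarrow> nat \<Rightarrow> ('q ^ 'n) set \<Rightarrow> nat" where
  "moment C t V = (\<Sum>c\<in>annihilated \<iota> C V. (q ^ (CARD('n) - rank_weight \<iota> c)) ^ t)"

lemma moment_0: "moment C 0 V = card (annihilated \<iota> C V)"
  by (simp add: moment_def)

text \<open>Double counting of the pairs \<open>(c, x)\<close> with \<open>c\<close> annihilated by \<open>x\<close>.\<close>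

lemma moment_Suc:
  fixes C :: "('a ^ 'n) set"
  shows "moment C (Suc t) V = (\<Sum>x\<in>UNIV. moment C t (insert x V))"
proof -
  let ?f = "\<lambda>c :: 'a ^ 'n. (q ^ (CARD('n) - rank_weight \<iota> c)) ^ t"
  have "(\<Sum>x\<in>UNIV. moment C t (insert x V))
      = (\<Sum>x\<in>UNIV. \<Sum>c\<in>annihilated \<iota> C V. if pairing \<iota> c x = 0 then ?f c else 0)"
  proof (rule sum.cong)
    fix x :: "'q ^ 'n"
    have "annihilated \<iota> C (insert x V) = {c \<in> annihilated \<iota> C V. pairing \<iota> c x = 0}"
      by (auto simp: annihilated_def)
    then show "moment C t (insert x V)
        = (\<Sum>c\<in>annihilated \<iota> C V. if pairing \<iota> c x = 0 then ?f c else 0)"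
      by (simp only: moment_def) (rule sum.inter_filter, simp)
  qed simp
  also have "\<dots> = (\<Sum>c\<in>annihilated \<iota> C V. \<Sum>x\<in>UNIV. if pairing \<iota> c x = 0 then ?f c else 0)"
    by (rule sum.swap)
  also have "\<dots> = (\<Sum>c\<in>annihilated \<iota> C V. card {x. pairing \<iota> c x = 0} * ?f c)"
    by (simp add: sum.If_cases)
  \<comment> \<open>The number of \<open>x\<close> orthogonal to \<open>c\<close> is exactly the
    factor that raises the power from \<open>t\<close> to \<open>Suc t\<close>.\<close>
  also have "\<dots> = moment C (Suc t) V"
    by (simp add: card_pairing_kernel moment_def)
  finally show ?thesis ..
qed

lemma moment_empty:
  fixes C :: "('a ^ 'n) set"
  shows "moment C t {} = (\<Sum>w\<le>CARD('n). weight_distribution \<iota> C w * (q ^ (CARD('n) - w)) ^ t)"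
proof -
  have "moment C t {} = (\<Sum>c\<in>C. (q ^ (CARD('n) - rank_weight \<iota> c)) ^ t)"
    by (simp add: moment_def annihilated_def)
  also have "\<dots> = (\<Sum>w\<le>CARD('n). \<Sum>c\<in>{c \<in> C. rank_weight \<iota> c = w}. (q ^ (CARD('n) - rank_weight \<iota> c)) ^ t)"
    by (rule sum.group[symmetric]) (auto simp: rank_weight_le)
  also have "\<dots> = (\<Sum>w\<le>CARD('n). weight_distribution \<iota> C w * (q ^ (CARD('n) - w)) ^ t)"
    by (intro sum.cong) (simp_all add: weight_distribution_def)
  finally show ?thesis .
qed

end

text \<open>The five terms distinguish whether the adjoined vector lies in the span of \<open>V\<close>, and whether
  its components lie in the spans of the projections of \<open>V\<close>.\<close>

primrec type_moment :: "nat \<Rightarrow> nat \<Rightarrow> nat \<Rightarrow> (nat \<Rightarrow> nat \<Rightarrow> nat \<Rightarrow> nat) \<Rightarrow> nat \<Rightarrow> nat \<Rightarrow> nat \<Rightarrow> nat \<Rightarrow> nat"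
  where
  "type_moment q n1 n2 g 0 = g"
| "type_moment q n1 n2 g (Suc t) = (\<lambda>r r1 r2. let M = type_moment q n1 n2 g t in
     q ^ r * M r r1 r2 + (q ^ (r1 + r2) - q ^ r) * M (Suc r) r1 r2
     + q ^ r1 * (q ^ n2 - q ^ r2) * M (Suc r) r1 (Suc r2)
     + (q ^ n1 - q ^ r1) * q ^ r2 * M (Suc r) (Suc r1) r2
     + (q ^ n1 - q ^ r1) * (q ^ n2 - q ^ r2) * M (Suc r) (Suc r1) (Suc r2))"

text \<open>Both sides obey the same recursion in \<open>t\<close>; \<open>V\<close> varies in the
  induction because the step enlarges it.\<close>

lemma (in nk_MRD) moment_eq_type_moment:
  "moment C t V = type_moment q n1 n2 (type_weight (q ^ m) k1 k2) t
     (vec.dim V) (vec.dim (fst_part ` V)) (vec.dim (snd_part ` V))"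
  by (induction t arbitrary: V)
    (simp_all only: moment_0 card_annihilated moment_Suc sum_insert_type type_moment.simps Let_def)

text \<open>The empty set has type \<open>0 0 0\<close>. Stated outside the locale, the result can
  be applied to two codes over different fields.\<close>

lemma nk_MRD_moments:
  fixes \<iota> :: "'q::{field,finite} \<Rightarrow> 'a::{field,finite}"
    and C :: "('a ^ ('n1::finite + 'n2::finite)) set"
  assumes "k1 < n1" "k2 < n2" "finite_field_extension \<iota> q m" "nk_MRD_code \<iota> (n1, n2) (k1, k2) C"
  shows "(\<Sum>w\<le>n1 + n2. weight_distribution \<iota> C w * (q ^ (n1 + n2 - w)) ^ t)
    = type_moment q n1 n2 (type_weight (q ^ m) k1 k2) t 0 0 0"
proof -
  obtain C1 :: "('a ^ 'n1) set" and C2 :: "('a ^ 'n2) set"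
    where C_eq: "C = code_sum C1 C2" and "nk_MRD \<iota> q m C1 C2 n1 n2 k1 k2"
    using assms unfolding nk_MRD_def nk_MRD_axioms_def ffext_def nk_MRD_code_def by auto
  then interpret nk_MRD \<iota> q m C1 C2 n1 n2 k1 k2 by simp
  show ?thesis
    using moment_eq_type_moment[of t "{}"] moment_empty[of "code_sum C1 C2" t] card_indices
    by (simp add: C_eq)
qed

theorem theorem2p29:
  fixes \<iota> :: "'q::{field,finite} \<Rightarrow> 'a::{field,finite}"
    and \<iota>' :: "'p::{field,finite} \<Rightarrow> 'b::{field,finite}"
    and C :: "('a ^ ('n1::finite + 'n2::finite)) set"
    and C' :: "('b ^ ('l1::finite + 'l2::finite)) set"
    and q m n1 n2 k1 k2 :: nat
  assumes "k1 < n1" and "n1 \<le> m" and "k2 < n2" and "n2 \<le> m"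
    and "finite_field_extension \<iota> q m" and "nk_MRD_code \<iota> (n1, n2) (k1, k2) C"
    and "finite_field_extension \<iota>' q m" and "nk_MRD_code \<iota>' (n1, n2) (k1, k2) C'"
  shows "\<forall>i \<in> {0..n1 + n2}. weight_distribution \<iota> C i = weight_distribution \<iota>' C' i"
proof
  fix i assume "i \<in> {0..n1 + n2}"
  then have i: "i \<le> n1 + n2" by simp
  have "2 \<le> q" by (rule ffext.q_ge_2[OF ffext.intro]) fact
  \<comment> \<open>Both families of power sums equal the same \<open>type_moment\<close> term, in
    which neither the code nor the field homomorphism occurs.\<close>
  from this _ i show "weight_distribution \<iota> C i = weight_distribution \<iota>' C' i"
    by (rule moments_determine)
      (simp only: nk_MRD_moments[OF assms(1,3,5,6)] nk_MRD_moments[OF assms(1,3,7,8)])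
qed

end
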